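(* $V_{\mathbb{BZL}}(\mathbf{D}_5)$ coincides with the variety of Kleene-Stone algebras.
   Context: $\mathbf{D}_5$ is the algebra $(D_5,\wedge,\vee,{}',{}^{\sim},0,1)$ on the $5$-element chain, with its unique order-reversing involution $'$ and with $0^{\sim}=1$, $a^{\sim}=0$ for $a\ne0$. $V_{\mathbb{BZL}}(\mathbf{D}_5)$ is the variety generated by $\mathbf{D}_5$ (in the type $(2,2,1,1,0,0)$ of $\wedge,\vee,{}',{}^{\sim},0,1$). A quasi-Stone algebra is an algebra $(A,\wedge,\vee,{}^{\sim},0,1)$ such that $(A,\wedge,\vee,0,1)$ is a bounded distributive lattice and, for all $a,b\in A$: $0^{\sim}=1$ and $1^{\sim}=0$; $(a\vee b)^{\sim}=a^{\sim}\wedge b^{\sim}$; $(a\wedge b^{\sim})^{\sim}=a^{\sim}\vee b^{\sim\sim}$; $a\le a^{\sim\sim}$; $a^{\sim}\vee a^{\sim\sim}=1$. It is a Stone algebra if moreover $(a\wedge b)^{\sim}=a^{\sim}\vee b^{\sim}$ for all $a,b$. Put $B(\mathbf{A})=\{a^{\sim}:a\in A\}$. A De Morgan algebra is an algebra $(A,\wedge,\vee,{}',0,1)$ with a bounded distributive lattice reduct and an order-reversing operation $'$ with $a''=a$; it is a Kleene algebra if moreover $a\wedge a'\le b\vee b'$ for all $a,b$. A quasi-Stone De Morgan algebra is an algebra $(A,\wedge,\vee,{}',{}^{\sim},0,1)$ such that $(A,\wedge,\vee,{}',0,1)$ is a De Morgan algebra, $(A,\wedge,\vee,{}^{\sim},0,1)$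 is a quasi-Stone algebra and $a'\in B(\mathbf{A})$ whenever $a\in B(\mathbf{A})$. A Kleene-Stone algebra is a quasi-Stone De Morgan algebra whose reduct $(A,\wedge,\vee,{}',0,1)$ is a Kleene algebra and whose reduct $(A,\wedge,\vee,{}^{\sim},0,1)$ is a Stone algebra. *)

theory Defs
  imports "HOL-Library.FuncSet"
begin

section \<open>Algebras of type (2,2,1,1,0,0)\<close>

record 'a bz_alg =
  carrier :: "'a set"
  meet :: "'a \<Rightarrow> 'a \<Rightarrow> 'a"  (infixl "\<sqinter>\<index>" 70)
  join :: "'a \<Rightarrow> 'a \<Rightarrow> 'a"  (infixl "\<squnion>\<index>" 65)
  neg :: "'a \<Rightarrow> 'a"  ("\<^bold>\<not>\<index> _" [81] 80)
  til :: "'a \<Rightarrow> 'a"  ("\<sim>\<index> _" [81] 80)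
  zero :: 'a  ("\<zero>\<index>")
  one :: 'a  ("\<one>\<index>")

locale bz_algebra =
  fixes A :: "'a bz_alg" (structure)
  assumes meet_closed: "x \<in> carrier A \<Longrightarrow> y \<in> carrier A \<Longrightarrow> x \<sqinter> y \<in> carrier A"
    and join_closed: "x \<in> carrier A \<Longrightarrow> y \<in> carrier A \<Longrightarrow> x \<squnion> y \<in> carrier A"
    and neg_closed: "x \<in> carrier A \<Longrightarrow> \<^bold>\<not> x \<in> carrier A"
    and til_closed: "x \<in> carrier A \<Longrightarrow> \<sim> x \<in> carrier A"
    and zero_closed: "\<zero> \<in> carrier A"
    and one_closed: "\<one> \<in> carrier A"

definition alg_le :: "'a bz_alg \<Rightarrow> 'a \<Rightarrow> 'a \<Rightarrow> bool"  (infix "\<sqsubseteq>\<index>" 50)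
  where "x \<sqsubseteq>\<^bsub>A\<^esub> y \<longleftrightarrow> x \<sqinter>\<^bsub>A\<^esub> y = x"


section \<open>Kleene-Stone algebras\<close>

locale bounded_distrib_lattice_alg = bz_algebra +
  assumes meet_assoc:
      "\<lbrakk>x \<in> carrier A; y \<in> carrier A; z \<in> carrier A\<rbrakk> \<Longrightarrow> (x \<sqinter> y) \<sqinter> z = x \<sqinter> (y \<sqinter> z)"
    and join_assoc:
      "\<lbrakk>x \<in> carrier A; y \<in> carrier A; z \<in> carrier A\<rbrakk> \<Longrightarrow> (x \<squnion> y) \<squnion> z = x \<squnion> (y \<squnion> z)"
    and meet_comm: "\<lbrakk>x \<in> carrier A; y \<in> carrier A\<rbrakk> \<Longrightarrow> x \<sqinter> y = y \<sqinter> x"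
    and join_comm: "\<lbrakk>x \<in> carrier A; y \<in> carrier A\<rbrakk> \<Longrightarrow> x \<squnion> y = y \<squnion> x"
    and meet_join_absorb: "\<lbrakk>x \<in> carrier A; y \<in> carrier A\<rbrakk> \<Longrightarrow> x \<sqinter> (x \<squnion> y) = x"
    and join_meet_absorb: "\<lbrakk>x \<in> carrier A; y \<in> carrier A\<rbrakk> \<Longrightarrow> x \<squnion> (x \<sqinter> y) = x"
    and meet_join_distrib:
      "\<lbrakk>x \<in> carrier A; y \<in> carrier A; z \<in> carrier A\<rbrakk>
        \<Longrightarrow> x \<sqinter> (y \<squnion> z) = (x \<sqinter> y) \<squnion> (x \<sqinter> z)"
    and zero_least: "x \<in> carrier A \<Longrightarrow> \<zero> \<sqsubseteq> x"
    and one_greatest: "x \<in> carrier A \<Longrightarrow> x \<sqsubseteq> \<one>"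

locale de_morgan_alg = bounded_distrib_lattice_alg +
  assumes neg_antitone:
      "\<lbrakk>x \<in> carrier A; y \<in> carrier A; x \<sqsubseteq> y\<rbrakk> \<Longrightarrow> \<^bold>\<not> y \<sqsubseteq> \<^bold>\<not> x"
    and neg_neg: "x \<in> carrier A \<Longrightarrow> \<^bold>\<not> (\<^bold>\<not> x) = x"

locale kleene_alg = de_morgan_alg +
  assumes kleene:
    "\<lbrakk>x \<in> carrier A; y \<in> carrier A\<rbrakk> \<Longrightarrow> x \<sqinter> \<^bold>\<not> x \<sqsubseteq> y \<squnion> \<^bold>\<not> y"

locale quasi_stone_alg = bounded_distrib_lattice_alg +
  assumes til_zero: "\<sim> \<zero> = \<one>"
    and til_one: "\<sim> \<one> = \<zero>"
    and til_join: "\<lbrakk>x \<in> carrier A; y \<in> carrier A\<rbrakk> \<Longrightarrow> \<sim> (x \<squnion> y) = \<sim> x \<sqinter> \<sim> y"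
    and til_meet_til:
      "\<lbrakk>x \<in> carrier A; y \<in> carrier A\<rbrakk> \<Longrightarrow> \<sim> (x \<sqinter> \<sim> y) = \<sim> x \<squnion> \<sim> (\<sim> y)"
    and le_til_til: "x \<in> carrier A \<Longrightarrow> x \<sqsubseteq> \<sim> (\<sim> x)"
    and til_join_til_til: "x \<in> carrier A \<Longrightarrow> \<sim> x \<squnion> \<sim> (\<sim> x) = \<one>"

locale stone_alg = quasi_stone_alg +
  assumes til_meet: "\<lbrakk>x \<in> carrier A; y \<in> carrier A\<rbrakk> \<Longrightarrow> \<sim> (x \<sqinter> y) = \<sim> x \<squnion> \<sim> y"

definition til_image :: "'a bz_alg \<Rightarrow> 'a set"
  where "til_image A = {\<sim>\<^bsub>A\<^esub> a |a. a \<in> carrier A}"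

locale quasi_stone_de_morgan_alg = de_morgan_alg + quasi_stone_alg +
  assumes neg_til_image: "x \<in> til_image A \<Longrightarrow> \<^bold>\<not> x \<in> til_image A"

locale kleene_stone_alg = quasi_stone_de_morgan_alg + kleene_alg + stone_alg


section \<open>The five-element chain\<close>

definition D5 :: "nat bz_alg"
  where "D5 = \<lparr>carrier = {0..4}, meet = min, join = max, neg = (\<lambda>x. 4 - x),
    til = (\<lambda>x. if x = 0 then 4 else 0), zero = 0, one = 4\<rparr>"

lemma D5_neg_unique:
  assumes cl: "\<And>x. x \<in> {0..4::nat} \<Longrightarrow> f x \<in> {0..4::nat}"
    and anti: "\<And>x y. \<lbrakk>x \<in> {0..4}; y \<in> {0..4}; x \<le> y\<rbrakk> \<Longrightarrow> f y \<le> f x"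
    and inv: "\<And>x. x \<in> {0..4} \<Longrightarrow> f (f x) = x"
    and x: "x \<in> {0..4}"
  shows "f x = 4 - x"
proof -
  have *: "f (Suc y) < f y" if "y < 4" for y
    using anti[of y "Suc y"] inv[of y] inv[of "Suc y"] that
    by (metis atLeastAtMost_iff le_neq_implies_less less_eq_Suc_le less_or_eq_imp_le
        n_not_Suc_n zero_le lessI)
  have "f 1 < f 0" "f 2 < f 1" "f 3 < f 2" "f 4 < f 3"
    using *[of 0] *[of 1] *[of 2] *[of 3] by (simp_all add: numeral_eq_Suc)
  moreover have "f 0 \<le> 4" using cl[of 0] by simp
  moreover have "x = 0 \<or> x = 1 \<or> x = 2 \<or> x = 3 \<or> x = 4" using x by auto
  ultimately show ?thesis by auto
qed

lemma D5_kleene_stone: "kleene_stone_alg D5"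
proof unfold_locales
  fix x assume "x \<in> til_image D5"
  then have "x = 0 \<or> x = 4" by (auto simp: til_image_def D5_def split: if_splits)
  moreover have "4 \<in> til_image D5"
    unfolding til_image_def D5_def mem_Collect_eq by (rule exI[of _ 0]) simp
  moreover have "0 \<in> til_image D5"
    unfolding til_image_def D5_def mem_Collect_eq by (rule exI[of _ 1]) simp
  ultimately show "\<^bold>\<not>\<^bsub>D5\<^esub> x \<in> til_image D5" by (auto simp: D5_def)
qed (auto simp: D5_def alg_le_def min_def max_def split: if_splits)


section \<open>Terms, identities and generated varieties\<close>

datatype 'v tm =
    Var 'v
  | Meet "'v tm" "'v tm"
  | Join "'v tm" "'v tm"
  | Neg "'v tm"
  | Til "'v tm"
  | Zero
  | One

primrec eval :: "'a bz_alg \<Rightarrow> ('v \<Rightarrow> 'a) \<Rightarrow> 'v tm \<Rightarrow> 'a" where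
  "eval A \<rho> (Var v) = \<rho> v"
| "eval A \<rho> (Meet s t) = eval A \<rho> s \<sqinter>\<^bsub>A\<^esub> eval A \<rho> t"
| "eval A \<rho> (Join s t) = eval A \<rho> s \<squnion>\<^bsub>A\<^esub> eval A \<rho> t"
| "eval A \<rho> (Neg t) = \<^bold>\<not>\<^bsub>A\<^esub> (eval A \<rho> t)"
| "eval A \<rho> (Til t) = \<sim>\<^bsub>A\<^esub> (eval A \<rho> t)"
| "eval A \<rho> Zero = \<zero>\<^bsub>A\<^esub>"
| "eval A \<rho> One = \<one>\<^bsub>A\<^esub>"

definition satisfies :: "'a bz_alg \<Rightarrow> 'v tm \<times> 'v tm \<Rightarrow> bool"
  where "satisfies A e \<longleftrightarrow>
    (\<forall>\<rho>. range \<rho> \<subseteq> carrier A \<longrightarrow> eval A \<rho> (fst e) = eval A \<rho> (snd e))"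

definition equational_class :: "(nat tm \<times> nat tm) set \<Rightarrow> 'a bz_alg set"
  where "equational_class E = {A. bz_algebra A \<and> (\<forall>e\<in>E. satisfies A e)}"

text \<open>A variety is an equational class, and the variety generated by \<open>K\<close> is the smallest
  variety containing \<open>K\<close>.  As HOL has no collection of algebras over all types,
  \<open>generated_variety K\<close> is the part of it consisting of the algebras whose carrier lies in a
  type \<open>'a\<close>, which is unrelated to the type of \<open>K\<close>.  The theorem
  \<open>generated_variety_eq_HSP\<close> below shows that these are exactly the homomorphic images of
  subalgebras of powers of \<open>K\<close>; powers indexed by \<open>'a \<Rightarrow> 'b\<close> suffice, and no other
  index type gives more.\<close>

definition generated_variety :: "'b bz_alg \<Rightarrow> 'a bz_alg set"
  where "generated_variety K = {A. \<forall>E. K \<in> equational_class E \<longrightarrow> A \<in> equational_class E}"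


section \<open>Homomorphic images of subalgebras of powers\<close>

definition subalgebra :: "'a set \<Rightarrow> 'a bz_alg \<Rightarrow> bool"
  where "subalgebra S A \<longleftrightarrow> S \<subseteq> carrier A \<and> bz_algebra (A\<lparr>carrier := S\<rparr>)"

definition alg_power :: "'i set \<Rightarrow> 'b bz_alg \<Rightarrow> ('i \<Rightarrow> 'b) bz_alg"
  where "alg_power I K = \<lparr>carrier = I \<rightarrow>\<^sub>E carrier K,
    meet = (\<lambda>f g. \<lambda>i\<in>I. f i \<sqinter>\<^bsub>K\<^esub> g i), join = (\<lambda>f g. \<lambda>i\<in>I. f i \<squnion>\<^bsub>K\<^esub> g i),
    neg = (\<lambda>f. \<lambda>i\<in>I. \<^bold>\<not>\<^bsub>K\<^esub> (f i)), til = (\<lambda>f. \<lambda>i\<in>I. \<sim>\<^bsub>K\<^esub> (f i)),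
    zero = (\<lambda>i\<in>I. \<zero>\<^bsub>K\<^esub>), one = (\<lambda>i\<in>I. \<one>\<^bsub>K\<^esub>)\<rparr>"

definition alg_hom :: "'a bz_alg \<Rightarrow> 'b bz_alg \<Rightarrow> ('a \<Rightarrow> 'b) set"
  where "alg_hom A B = {h. h \<in> carrier A \<rightarrow> carrier B \<and>
    (\<forall>x\<in>carrier A. \<forall>y\<in>carrier A. h (x \<sqinter>\<^bsub>A\<^esub> y) = h x \<sqinter>\<^bsub>B\<^esub> h y) \<and>
    (\<forall>x\<in>carrier A. \<forall>y\<in>carrier A. h (x \<squnion>\<^bsub>A\<^esub> y) = h x \<squnion>\<^bsub>B\<^esub> h y) \<and>
    (\<forall>x\<in>carrier A. h (\<^bold>\<not>\<^bsub>A\<^esub> x) = \<^bold>\<not>\<^bsub>B\<^esub> (h x)) \<and>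
    (\<forall>x\<in>carrier A. h (\<sim>\<^bsub>A\<^esub> x) = \<sim>\<^bsub>B\<^esub> (h x)) \<and>
    h \<zero>\<^bsub>A\<^esub> = \<zero>\<^bsub>B\<^esub> \<and> h \<one>\<^bsub>A\<^esub> = \<one>\<^bsub>B\<^esub>}"

definition HSP :: "'i itself \<Rightarrow> 'b bz_alg \<Rightarrow> 'a bz_alg set"
  where "HSP _ K = {A. bz_algebra A \<and> (\<exists>(I::'i set) S h. subalgebra S (alg_power I K) \<and>
    h \<in> alg_hom ((alg_power I K)\<lparr>carrier := S\<rparr>) A \<and> h ` S = carrier A)}"

lemma eval_closed:
  assumes "bz_algebra A" "\<And>v. v \<in> set_tm t \<Longrightarrow> \<rho> v \<in> carrier A"
  shows "eval A \<rho> t \<in> carrier A"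
proof -
  interpret bz_algebra A by fact
  show ?thesis using assms(2)
    by (induction t)
      (auto intro: meet_closed join_closed neg_closed til_closed zero_closed one_closed)
qed

lemma eval_map: "eval A \<rho> (map_tm f t) = eval A (\<rho> \<circ> f) t"
  by (induction t) auto

lemma eval_cong: "(\<And>v. v \<in> set_tm t \<Longrightarrow> \<rho> v = \<sigma> v) \<Longrightarrow> eval A \<rho> t = eval A \<sigma> t"
  by (induction t) auto

lemma finite_set_tm: "finite (set_tm t)"
  by (induction t) auto

lemma eval_hom:
  assumes "bz_algebra B" "h \<in> alg_hom B A" "range \<rho> \<subseteq> carrier B"
  shows "h (eval B \<rho> t) = eval A (h \<circ> \<rho>) t"
proof (induction t)
qed (use assms(2) eval_closed[OF assms(1), of _ \<rho>] assms(3) in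
      \<open>auto simp: alg_hom_def image_subset_iff\<close>)

lemma eval_sub: "eval (A\<lparr>carrier := S\<rparr>) \<rho> t = eval A \<rho> t"
  by (induction t) auto

lemma eval_power: "i \<in> I \<Longrightarrow> eval (alg_power I K) \<rho> t i = eval K (\<lambda>v. \<rho> v i) t"
  by (induction t) (auto simp: alg_power_def)

lemma bz_algebra_power: "bz_algebra K \<Longrightarrow> bz_algebra (alg_power I K)"
  unfolding bz_algebra_def alg_power_def by (auto simp: PiE_iff)

lemma HSP_subset_generated_variety:
  assumes K: "bz_algebra K"
  shows "HSP TYPE('i) K \<subseteq> generated_variety K"
proof
  fix A assume "A \<in> HSP TYPE('i) K"
  then obtain I :: "'i set" and S h where A: "bz_algebra A"
    and S: "subalgebra S (alg_power I K)"
    and h: "h \<in> alg_hom ((alg_power I K)\<lparr>carrier := S\<rparr>) A" and sur: "h ` S = carrier A"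
    by (auto simp: HSP_def)
  have "satisfies A e" if e: "satisfies K e" for e :: "nat tm \<times> nat tm"
    unfolding satisfies_def
  proof (intro allI impI)
    fix \<rho> :: "nat \<Rightarrow> _" assume "range \<rho> \<subseteq> carrier A"
    then have "\<forall>v. \<exists>s\<in>S. h s = \<rho> v" using sur by (metis image_iff image_subset_iff UNIV_I)
    then obtain \<sigma> where \<sigma>: "\<And>v. \<sigma> v \<in> S" "\<And>v. h (\<sigma> v) = \<rho> v" by metis
    have bS: "bz_algebra ((alg_power I K)\<lparr>carrier := S\<rparr>)" and SS: "S \<subseteq> I \<rightarrow>\<^sub>E carrier K"
      using S by (auto simp: subalgebra_def alg_power_def)
    have ev: "eval A \<rho> t = h (eval (alg_power I K) \<sigma> t)" for t
      using eval_hom[OF bS h, of \<sigma> t] \<sigma> by (simp add: eval_sub comp_def image_subset_iff)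
    have cl: "eval (alg_power I K) \<sigma> t \<in> I \<rightarrow>\<^sub>E carrier K" for t
      using eval_closed[OF bz_algebra_power[OF K, of I], of t \<sigma>] \<sigma> SS
      by (auto simp: alg_power_def)
    have "eval (alg_power I K) \<sigma> (fst e) = eval (alg_power I K) \<sigma> (snd e)"
    proof (rule PiE_ext[OF cl cl])
      fix i assume i: "i \<in> I"
      have "range (\<lambda>v. \<sigma> v i) \<subseteq> carrier K" using \<sigma> SS i by (auto simp: PiE_iff)
      then show "eval (alg_power I K) \<sigma> (fst e) i = eval (alg_power I K) \<sigma> (snd e) i"
        using e i by (simp add: eval_power satisfies_def)
    qed
    then show "eval A \<rho> (fst e) = eval A \<rho> (snd e)" by (simp add: ev)
  qed
  then show "A \<in> generated_variety K"
    using A by (auto simp: generated_variety_def equational_class_def)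
qed

lemma satisfies_transfer:
  fixes s t :: "'v tm"
  assumes K: "bz_algebra K" and A: "bz_algebra A"
    and ids: "\<And>e :: nat tm \<times> nat tm. satisfies K e \<Longrightarrow> satisfies A e"
    and eq: "\<And>\<rho>. (\<forall>v\<in>set_tm s \<union> set_tm t. \<rho> v \<in> carrier K) \<Longrightarrow> eval K \<rho> s = eval K \<rho> t"
    and \<sigma>: "\<forall>v\<in>set_tm s \<union> set_tm t. \<sigma> v \<in> carrier A"
  shows "eval A \<sigma> s = eval A \<sigma> t"
proof -
  let ?V = "set_tm s \<union> set_tm t"
  obtain f :: "'v \<Rightarrow> nat" where f: "inj_on f ?V"
    using finite_imp_inj_to_nat_seg[of ?V] finite_set_tm by (metis finite_UnI)
  have "satisfies K (map_tm f s, map_tm f t)"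
    using eq by (auto simp: satisfies_def eval_map image_subset_iff)
  then have sat: "satisfies A (map_tm f s, map_tm f t)" by (rule ids)
  define \<tau> where "\<tau> n = (if n \<in> f ` ?V then \<sigma> (the_inv_into ?V f n) else \<zero>\<^bsub>A\<^esub>)" for n
  have \<tau>f: "\<tau> (f v) = \<sigma> v" if "v \<in> ?V" for v
    using that the_inv_into_f_f[OF f that] by (auto simp: \<tau>_def)
  have "range \<tau> \<subseteq> carrier A"
  proof clarify
    fix n show "\<tau> n \<in> carrier A"
    proof (cases "n \<in> f ` ?V")
      case True
      then show ?thesis using \<tau>f \<sigma> by auto
    next
      case False
      then show ?thesis using bz_algebra.zero_closed[OF A] by (simp add: \<tau>_def)
    qed
  qed
  then have "eval A (\<tau> \<circ> f) s = eval A (\<tau> \<circ> f) t"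
    using sat by (auto simp: satisfies_def eval_map)
  moreover have "eval A (\<tau> \<circ> f) s = eval A \<sigma> s" "eval A (\<tau> \<circ> f) t = eval A \<sigma> t"
    by (auto intro!: eval_cong simp: \<tau>f)
  ultimately show ?thesis by simp
qed

lemma generated_variety_subset_HSP:
  fixes K :: "'b bz_alg"
  assumes K: "bz_algebra K"
  shows "(generated_variety K :: 'a bz_alg set) \<subseteq> HSP TYPE('a \<Rightarrow> 'b) K"
proof
  fix A :: "'a bz_alg" assume gv: "A \<in> generated_variety K"
  have "K \<in> equational_class {e. satisfies K e}" using K by (auto simp: equational_class_def)
  then have "A \<in> equational_class {e. satisfies K e}"
    using gv by (auto simp: generated_variety_def)
  then have A: "bz_algebra A"
    and ids: "\<And>e :: nat tm \<times> nat tm. satisfies K e \<Longrightarrow> satisfies A e"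
    by (auto simp: equational_class_def)
  define I where "I = carrier A \<rightarrow>\<^sub>E carrier K"
  define T where "T = {t :: 'a tm. set_tm t \<subseteq> carrier A}"
  define F where "F t = (\<lambda>\<rho>\<in>I. eval K \<rho> t)" for t :: "'a tm"
  define G where "G f = eval A id (SOME t. t \<in> T \<and> F t = f)" for f
  have wd: "eval A id s = eval A id t" if st: "s \<in> T" "t \<in> T" "F s = F t" for s t
  proof (rule satisfies_transfer[OF K A ids])
    fix \<rho> :: "'a \<Rightarrow> 'b" assume \<rho>: "\<forall>v\<in>set_tm s \<union> set_tm t. \<rho> v \<in> carrier K"
    define \<rho>' where "\<rho>' = (\<lambda>v\<in>carrier A. if v \<in> set_tm s \<union> set_tm t then \<rho> v else \<zero>\<^bsub>K\<^esub>)"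
    have "\<rho>' \<in> I" using \<rho> bz_algebra.zero_closed[OF K] by (auto simp: I_def \<rho>'_def)
    then have "eval K \<rho>' s = eval K \<rho>' t" using fun_cong[OF st(3), of \<rho>'] by (simp add: F_def)
    moreover have "eval K \<rho>' s = eval K \<rho> s" "eval K \<rho>' t = eval K \<rho> t"
      using st(1,2) by (auto intro!: eval_cong simp: \<rho>'_def T_def)
    ultimately show "eval K \<rho> s = eval K \<rho> t" by simp
  qed (use st in \<open>auto simp: T_def\<close>)
  have GF: "G (F t) = eval A id t" if "t \<in> T" for t
  proof -
    have "\<exists>s. s \<in> T \<and> F s = F t" using that by blast
    then have "(SOME s. s \<in> T \<and> F s = F t) \<in> T \<and> F (SOME s. s \<in> T \<and> F s = F t) = F t"
      by (rule someI_ex)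
    then show ?thesis unfolding G_def using wd that by blast
  qed
  let ?P = "alg_power I K"
  have ops: "F s \<sqinter>\<^bsub>?P\<^esub> F t = F (Meet s t)" "F s \<squnion>\<^bsub>?P\<^esub> F t = F (Join s t)"
      "\<^bold>\<not>\<^bsub>?P\<^esub> (F s) = F (Neg s)" "\<sim>\<^bsub>?P\<^esub> (F s) = F (Til s)"
      "\<zero>\<^bsub>?P\<^esub> = F Zero" "\<one>\<^bsub>?P\<^esub> = F One" for s t
    by (auto simp: F_def alg_power_def restrict_def fun_eq_iff)
  have Ts: "s \<in> T \<Longrightarrow> t \<in> T \<Longrightarrow> Meet s t \<in> T" "s \<in> T \<Longrightarrow> t \<in> T \<Longrightarrow> Join s t \<in> T"
      "s \<in> T \<Longrightarrow> Neg s \<in> T" "s \<in> T \<Longrightarrow> Til s \<in> T" "Zero \<in> T" "One \<in> T" for s t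
    by (auto simp: T_def)
  have sub: "subalgebra (F ` T) ?P"
    unfolding subalgebra_def
  proof
    show "F ` T \<subseteq> carrier ?P"
    proof clarify
      fix t assume "t \<in> T"
      then show "F t \<in> carrier ?P"
        by (auto simp: alg_power_def F_def T_def I_def intro!: eval_closed[OF K])
    qed
    show "bz_algebra (?P\<lparr>carrier := F ` T\<rparr>)"
      by unfold_locales (auto simp: ops Ts)
  qed
  have hom: "G \<in> alg_hom (?P\<lparr>carrier := F ` T\<rparr>) A"
    by (auto simp: alg_hom_def ops Ts GF T_def subset_iff intro!: eval_closed[OF A])
  have "G ` F ` T = carrier A"
  proof
    show "G ` F ` T \<subseteq> carrier A" using hom by (auto simp: alg_hom_def)
    show "carrier A \<subseteq> G ` F ` T"
    proof
      fix a assume "a \<in> carrier A"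
      then have "Var a \<in> T" by (simp add: T_def)
      then show "a \<in> G ` F ` T" using GF[of "Var a"] by (force simp: image_iff)
    qed
  qed
  with A sub hom show "A \<in> HSP TYPE('a \<Rightarrow> 'b) K" by (auto simp: HSP_def)
qed

theorem generated_variety_eq_HSP:
  fixes K :: "'b bz_alg"
  assumes "bz_algebra K"
  shows "(generated_variety K :: 'a bz_alg set) = HSP TYPE('a \<Rightarrow> 'b) K"
    and "HSP TYPE('i) K \<subseteq> (generated_variety K :: 'a bz_alg set)"
  using HSP_subset_generated_variety[OF assms] generated_variety_subset_HSP[OF assms] by blast+

end

theory Submission
  imports Defs
begin

text \<open>
  The inclusion from left to right says that the Kleene-Stone axioms can be written as
  identities.  Only two of them are not identities as they stand.  Antitonicity of the negation
  is the identity \<open>\<^bold>\<not> y \<sqsubseteq> \<^bold>\<not> (x \<sqinter> y)\<close>, and closure of the image of \<open>\<sim>\<close> under the negation follows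
  from \<open>\<^bold>\<not> \<sim> x = \<sim> \<sim> x\<close>.  The latter holds in every Kleene-Stone algebra (\<open>neg_til\<close>), because the
  Kleene law forces the negation of a complemented element to be its complement.

  For the converse it is enough to separate the points of a Kleene-Stone algebra by homomorphisms
  into the chain \<open>D5\<close>, since an identity that fails in the algebra then fails in \<open>D5\<close>.  A lattice
  homomorphism into a five-element chain is the same as a chain of four prime filters, and an
  element is sent to the number of these filters that contain it.  Of two distinct elements
  one, say \<open>x\<close>, is not below the other, \<open>y\<close>, and then there is a prime filter \<open>P\<close> with \<open>x\<close> in \<open>P\<close>
  and \<open>y\<close> outside (\<open>prime_filter_separation\<close>).  Its dual
  \<open>{a. \<^bold>\<not> a \<notin> P}\<close> is again a prime filter, and by the Kleene law it is comparable with \<open>P\<close>.  Since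
  \<open>\<sim> \<sim>\<close> is a lattice homomorphism in a Stone algebra, \<open>{a. \<sim> \<sim> a \<in> P}\<close> is also prime; it contains
  \<open>P\<close> and its dual, so its own dual \<open>{a. \<sim> \<^bold>\<not> a \<in> P}\<close> is contained in both.  These four filters
  form a chain that the duality reverses, hence the counting map turns the negation into
  \<open>k \<mapsto> 4 - k\<close>.  The four filters contain the same elements of the image of \<open>\<sim>\<close>, and the
  counting map vanishes at \<open>a\<close> exactly when \<open>\<sim> a \<in> P\<close>; so it also preserves \<open>\<sim>\<close>.
\<close>

section \<open>Prime filters of bounded distributive lattices\<close>

context bounded_distrib_lattice_alg
begin

lemmas closed = meet_closed join_closed neg_closed til_closed zero_closed one_closed

lemma meet_idem: "x \<in> carrier A \<Longrightarrow> x \<sqinter> x = x"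
  by (metis join_meet_absorb meet_closed meet_join_absorb)

lemma le_refl: "x \<in> carrier A \<Longrightarrow> x \<sqsubseteq> x"
  by (simp add: alg_le_def meet_idem)

lemma le_trans:
  "\<lbrakk>x \<in> carrier A; y \<in> carrier A; z \<in> carrier A; x \<sqsubseteq> y; y \<sqsubseteq> z\<rbrakk> \<Longrightarrow> x \<sqsubseteq> z"
  unfolding alg_le_def by (metis meet_assoc)

lemma le_antisym: "\<lbrakk>x \<in> carrier A; y \<in> carrier A; x \<sqsubseteq> y; y \<sqsubseteq> x\<rbrakk> \<Longrightarrow> x = y"
  unfolding alg_le_def by (metis meet_comm)

lemma meet_le1: "\<lbrakk>x \<in> carrier A; y \<in> carrier A\<rbrakk> \<Longrightarrow> x \<sqinter> y \<sqsubseteq> x"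
  unfolding alg_le_def by (metis meet_assoc meet_comm meet_idem meet_closed)

lemma meet_le2: "\<lbrakk>x \<in> carrier A; y \<in> carrier A\<rbrakk> \<Longrightarrow> x \<sqinter> y \<sqsubseteq> y"
  by (metis meet_comm meet_le1)

lemma le_meet:
  "\<lbrakk>x \<in> carrier A; y \<in> carrier A; z \<in> carrier A; z \<sqsubseteq> x; z \<sqsubseteq> y\<rbrakk> \<Longrightarrow> z \<sqsubseteq> x \<sqinter> y"
  unfolding alg_le_def by (metis meet_assoc)

lemma meet_le_mono_trans:
  assumes c: "u \<in> carrier A" "v \<in> carrier A" "a \<in> carrier A" "z \<in> carrier A"
    and le: "u \<sqsubseteq> v" "v \<sqinter> a \<sqsubseteq> z"
  shows "u \<sqinter> a \<sqsubseteq> z"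
proof -
  have "u \<sqinter> a \<sqsubseteq> v"
    using le_trans[OF _ c(1,2) meet_le1 le(1)] c by (simp add: meet_closed)
  then have "u \<sqinter> a \<sqsubseteq> v \<sqinter> a" using c by (simp add: le_meet meet_closed meet_le2)
  then show ?thesis using le_trans[of "u \<sqinter> a" "v \<sqinter> a" z] le(2) c by (simp add: meet_closed)
qed

lemma le_join1: "\<lbrakk>x \<in> carrier A; y \<in> carrier A\<rbrakk> \<Longrightarrow> x \<sqsubseteq> x \<squnion> y"
  by (simp add: alg_le_def meet_join_absorb)

lemma le_join2: "\<lbrakk>x \<in> carrier A; y \<in> carrier A\<rbrakk> \<Longrightarrow> y \<sqsubseteq> x \<squnion> y"
  by (metis join_comm le_join1)

lemma join_le:
  "\<lbrakk>x \<in> carrier A; y \<in> carrier A; z \<in> carrier A; x \<sqsubseteq> z; y \<sqsubseteq> z\<rbrakk> \<Longrightarrow> x \<squnion> y \<sqsubseteq> z"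
  unfolding alg_le_def by (metis meet_comm meet_join_distrib join_closed)

lemma join_eq: "\<lbrakk>x \<in> carrier A; y \<in> carrier A; x \<sqsubseteq> y\<rbrakk> \<Longrightarrow> x \<squnion> y = y"
  by (metis join_le le_antisym le_join2 le_refl join_closed)

lemma meet_one: "x \<in> carrier A \<Longrightarrow> x \<sqinter> \<one> = x"
  using one_greatest by (simp add: alg_le_def)

lemma zero_join: "x \<in> carrier A \<Longrightarrow> \<zero> \<squnion> x = x"
  by (simp add: join_eq zero_closed zero_least)

definition lattice_filter :: "'a set \<Rightarrow> bool" where
  "lattice_filter F \<longleftrightarrow> F \<subseteq> carrier A \<and> \<one> \<in> F \<and>
    (\<forall>a\<in>carrier A. \<forall>b\<in>carrier A. a \<sqinter> b \<in> F \<longleftrightarrow> a \<in> F \<and> b \<in> F)"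

definition prime_filter :: "'a set \<Rightarrow> bool" where
  "prime_filter F \<longleftrightarrow> lattice_filter F \<and> \<zero> \<notin> F \<and>
    (\<forall>a\<in>carrier A. \<forall>b\<in>carrier A. a \<squnion> b \<in> F \<longleftrightarrow> a \<in> F \<or> b \<in> F)"

lemma filter_up: "\<lbrakk>lattice_filter F; a \<in> F; b \<in> carrier A; a \<sqsubseteq> b\<rbrakk> \<Longrightarrow> b \<in> F"
  unfolding lattice_filter_def alg_le_def by (metis subsetD)

lemma lattice_filterI:
  assumes "F \<subseteq> carrier A" "\<one> \<in> F" "\<And>a b. a \<in> F \<Longrightarrow> b \<in> F \<Longrightarrow> a \<sqinter> b \<in> F"
    and "\<And>a b. a \<in> F \<Longrightarrow> b \<in> carrier A \<Longrightarrow> a \<sqsubseteq> b \<Longrightarrow> b \<in> F"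
  shows "lattice_filter F"
  unfolding lattice_filter_def using assms meet_le1 meet_le2 by blast

text \<open>The filter generated by \<open>F\<close> and \<open>a\<close>, on which the maximality argument below rests.\<close>

lemma filter_extend:
  assumes F: "lattice_filter F" and a: "a \<in> carrier A"
  defines "G \<equiv> {c \<in> carrier A. \<exists>f\<in>F. f \<sqinter> a \<sqsubseteq> c}"
  shows "lattice_filter G" "F \<subseteq> G" "a \<in> G"
proof -
  have FA: "F \<subseteq> carrier A" and F1: "\<one> \<in> F" using F by (auto simp: lattice_filter_def)
  show "lattice_filter G"
  proof (rule lattice_filterI)
    show "\<one> \<in> G" using F1 a by (auto simp: G_def intro: closed one_greatest)
  next
    fix c d assume "c \<in> G" "d \<in> G"
    then obtain f g where *: "f \<in> F" "g \<in> F" "f \<sqinter> a \<sqsubseteq> c" "g \<sqinter> a \<sqsubseteq> d"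
      and cd: "c \<in> carrier A" "d \<in> carrier A" by (auto simp: G_def)
    have fg: "f \<in> carrier A" "g \<in> carrier A" using * FA by auto
    have "f \<sqinter> g \<in> F" using F fg * by (auto simp: lattice_filter_def)
    moreover have "(f \<sqinter> g) \<sqinter> a \<sqsubseteq> c" "(f \<sqinter> g) \<sqinter> a \<sqsubseteq> d"
      using meet_le_mono_trans[OF _ fg(1) a cd(1) meet_le1[OF fg] *(3)]
        meet_le_mono_trans[OF _ fg(2) a cd(2) meet_le2[OF fg] *(4)] fg
      by (simp_all add: meet_closed)
    then have "(f \<sqinter> g) \<sqinter> a \<sqsubseteq> c \<sqinter> d"
      using fg a cd by (simp add: le_meet meet_closed)
    ultimately show "c \<sqinter> d \<in> G" using cd by (auto simp: G_def meet_closed)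
  next
    fix c d assume "c \<in> G" "d \<in> carrier A" "c \<sqsubseteq> d"
    then show "d \<in> G" using FA a by (auto simp: G_def) (meson le_trans meet_closed subsetD)
  qed (auto simp: G_def)
  show "F \<subseteq> G" using FA a meet_le1 by (auto simp: G_def)
  show "a \<in> G" using F1 a meet_le2 one_closed by (auto simp: G_def)
qed

text \<open>A filter that is maximal among those containing \<open>x\<close> but not \<open>y\<close> is prime: if neither
  \<open>a\<close> nor \<open>b\<close> can be added to it, then \<open>f \<sqinter> a \<sqsubseteq> y\<close> and \<open>g \<sqinter> b \<sqsubseteq> y\<close> for some of its elements
  \<open>f\<close> and \<open>g\<close>, so by distributivity \<open>a \<squnion> b\<close> would put \<open>y\<close> into the filter.\<close>

lemma prime_filter_separation:
  assumes x: "x \<in> carrier A" and y: "y \<in> carrier A" and nle: "\<not> x \<sqsubseteq> y"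
  obtains P where "prime_filter P" "x \<in> P" "y \<notin> P"
proof -
  define \<F> where "\<F> = {F. lattice_filter F \<and> x \<in> F \<and> y \<notin> F}"
  have "{c \<in> carrier A. x \<sqsubseteq> c} \<in> \<F>"
    unfolding \<F>_def
    using x y nle by (auto intro!: lattice_filterI closed le_meet le_refl one_greatest
        intro: le_trans)
  then have ne: "\<F> \<noteq> {}" by blast
  have chain: "\<Union>C \<in> \<F>" if "C \<noteq> {}" "subset.chain \<F> C" for C
  proof -
    have C: "F \<in> \<F>" if "F \<in> C" for F using \<open>subset.chain \<F> C\<close> that
      by (auto simp: subset_chain_def)
    have "lattice_filter (\<Union>C)"
    proof (rule lattice_filterI)
      show "\<Union>C \<subseteq> carrier A" using C by (auto simp: \<F>_def lattice_filter_def)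
      show "\<one> \<in> \<Union>C" using C \<open>C \<noteq> {}\<close> by (auto simp: \<F>_def lattice_filter_def)
    next
      fix a b assume "a \<in> \<Union>C" "b \<in> \<Union>C"
      then obtain F G where "F \<in> C" "G \<in> C" "a \<in> F" "b \<in> G" by blast
      moreover then have "F \<subseteq> G \<or> G \<subseteq> F"
        using \<open>subset.chain \<F> C\<close> by (auto simp: subset_chain_def)
      ultimately obtain H where H: "H \<in> C" "a \<in> H" "b \<in> H" by blast
      then have "a \<sqinter> b \<in> H"
        using C[of H] unfolding \<F>_def lattice_filter_def by blast
      then show "a \<sqinter> b \<in> \<Union>C" using H by blast
    next
      fix a b assume "a \<in> \<Union>C" "b \<in> carrier A" "a \<sqsubseteq> b"
      then show "b \<in> \<Union>C" using C filter_up by (fastforce simp: \<F>_def)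
    qed
    then show ?thesis using C \<open>C \<noteq> {}\<close> by (auto simp: \<F>_def)
  qed
  obtain P where P: "P \<in> \<F>" and max: "\<And>F. F \<in> \<F> \<Longrightarrow> P \<subseteq> F \<Longrightarrow> F = P"
    using subset_Zorn_nonempty[OF ne chain] by blast
  have fP: "lattice_filter P" and xP: "x \<in> P" and yP: "y \<notin> P" using P by (auto simp: \<F>_def)
  have PA: "P \<subseteq> carrier A" using fP by (auto simp: lattice_filter_def)
  have ext: "\<exists>f\<in>P. f \<sqinter> a \<sqsubseteq> y" if "a \<in> carrier A" "a \<notin> P" for a
  proof (rule ccontr)
    assume "\<not> ?thesis"
    then have "{c \<in> carrier A. \<exists>f\<in>P. f \<sqinter> a \<sqsubseteq> c} \<in> \<F>"
      using filter_extend[OF fP that(1)] xP by (auto simp: \<F>_def)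
    then show False using max filter_extend[OF fP that(1)] that(2) by blast
  qed
  have "a \<squnion> b \<in> P \<longleftrightarrow> a \<in> P \<or> b \<in> P" if ab: "a \<in> carrier A" "b \<in> carrier A" for a b
  proof
    assume "a \<in> P \<or> b \<in> P"
    then show "a \<squnion> b \<in> P" using filter_up[OF fP] ab join_closed le_join1 le_join2 by blast
  next
    assume abP: "a \<squnion> b \<in> P"
    show "a \<in> P \<or> b \<in> P"
    proof (rule ccontr)
      assume "\<not> ?thesis"
      then obtain f g where fg: "f \<in> P" "g \<in> P" and *: "f \<sqinter> a \<sqsubseteq> y" "g \<sqinter> b \<sqsubseteq> y"
        using ext ab by meson
      have c: "f \<in> carrier A" "g \<in> carrier A" using fg PA by auto
      have "(f \<sqinter> g) \<sqinter> a \<sqsubseteq> y" "(f \<sqinter> g) \<sqinter> b \<sqsubseteq> y"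
        using meet_le_mono_trans[OF _ c(1) ab(1) y meet_le1[OF c] *(1)]
          meet_le_mono_trans[OF _ c(2) ab(2) y meet_le2[OF c] *(2)] c
        by (simp_all add: meet_closed)
      then have "((f \<sqinter> g) \<sqinter> a) \<squnion> ((f \<sqinter> g) \<sqinter> b) \<sqsubseteq> y"
        using c ab y by (simp add: join_le meet_closed)
      then have "(f \<sqinter> g) \<sqinter> (a \<squnion> b) \<sqsubseteq> y" using c ab by (simp add: meet_join_distrib meet_closed)
      moreover have "(f \<sqinter> g) \<sqinter> (a \<squnion> b) \<in> P"
        using fP fg c ab abP by (simp add: lattice_filter_def meet_closed join_closed)
      ultimately show False using filter_up[OF fP] y yP by blast
    qed
  qed
  moreover have "\<zero> \<notin> P" using filter_up[OF fP] y yP zero_least by blast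
  ultimately have "prime_filter P" using fP by (auto simp: prime_filter_def)
  then show thesis using that xP yP by blast
qed

end


section \<open>Duality of prime filters in De Morgan and Kleene algebras\<close>

context de_morgan_alg
begin

lemma le_neg_swap: "\<lbrakk>x \<in> carrier A; y \<in> carrier A; x \<sqsubseteq> \<^bold>\<not> y\<rbrakk> \<Longrightarrow> y \<sqsubseteq> \<^bold>\<not> x"
  by (metis neg_antitone neg_neg neg_closed)

lemma neg_join:
  assumes "x \<in> carrier A" "y \<in> carrier A"
  shows "\<^bold>\<not> (x \<squnion> y) = \<^bold>\<not> x \<sqinter> \<^bold>\<not> y"
proof (rule le_antisym)
  show "\<^bold>\<not> (x \<squnion> y) \<sqsubseteq> \<^bold>\<not> x \<sqinter> \<^bold>\<not> y"
    using assms by (simp add: closed le_meet neg_antitone le_join1 le_join2)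
  have "x \<sqsubseteq> \<^bold>\<not> (\<^bold>\<not> x \<sqinter> \<^bold>\<not> y)" "y \<sqsubseteq> \<^bold>\<not> (\<^bold>\<not> x \<sqinter> \<^bold>\<not> y)"
    using assms by (simp_all add: le_neg_swap meet_le1 meet_le2 closed)
  then show "\<^bold>\<not> x \<sqinter> \<^bold>\<not> y \<sqsubseteq> \<^bold>\<not> (x \<squnion> y)"
    using assms by (simp add: join_le le_neg_swap closed)
qed (use assms in \<open>auto intro: closed\<close>)

lemma neg_meet: "\<lbrakk>x \<in> carrier A; y \<in> carrier A\<rbrakk> \<Longrightarrow> \<^bold>\<not> (x \<sqinter> y) = \<^bold>\<not> x \<squnion> \<^bold>\<not> y"
  by (metis neg_join neg_neg neg_closed join_closed)

lemma neg_zero: "\<^bold>\<not> \<zero> = \<one>"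
proof (rule le_antisym)
  show "\<one> \<sqsubseteq> \<^bold>\<not> \<zero>" by (rule le_neg_swap) (simp_all add: closed zero_least)
qed (simp_all add: closed one_greatest)

lemma neg_one: "\<^bold>\<not> \<one> = \<zero>"
  by (metis neg_zero neg_neg zero_closed)

definition dual_filter :: "'a set \<Rightarrow> 'a set" where
  "dual_filter F = {a \<in> carrier A. \<^bold>\<not> a \<notin> F}"

lemma prime_filter_dual: "prime_filter F \<Longrightarrow> prime_filter (dual_filter F)"
  by (auto simp: prime_filter_def lattice_filter_def dual_filter_def closed neg_meet neg_join
      neg_zero neg_one)

lemma dual_dual: "F \<subseteq> carrier A \<Longrightarrow> dual_filter (dual_filter F) = F"
  by (auto simp: dual_filter_def closed neg_neg)

end

text \<open>If \<open>a\<close> lies in \<open>F\<close> but not in its dual and \<open>b\<close> in the dual but not in \<open>F\<close>, then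
  \<open>a \<sqinter> \<^bold>\<not> a\<close> is in \<open>F\<close> while \<open>b \<squnion> \<^bold>\<not> b\<close> is not, against the Kleene law.\<close>

lemma (in kleene_alg) dual_filter_comparable:
  assumes F: "prime_filter F"
  shows "F \<subseteq> dual_filter F \<or> dual_filter F \<subseteq> F"
proof (rule ccontr)
  assume "\<not> ?thesis"
  then obtain a b where a: "a \<in> F" "a \<notin> dual_filter F" and b: "b \<in> dual_filter F" "b \<notin> F"
    by blast
  have c: "a \<in> carrier A" "b \<in> carrier A"
    using a b F by (auto simp: dual_filter_def prime_filter_def lattice_filter_def)
  have "a \<sqinter> \<^bold>\<not> a \<in> F" "b \<squnion> \<^bold>\<not> b \<notin> F"
    using a b c F by (auto simp: dual_filter_def prime_filter_def lattice_filter_def closed)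
  then show False
    using filter_up[of F] kleene[OF c] c F by (auto simp: prime_filter_def closed)
qed


section \<open>The identities of Kleene-Stone algebras\<close>

text \<open>In a Kleene algebra complements are unique and given by the negation: the Kleene law for
  the pair \<open>a\<close>, \<open>c\<close> gives \<open>a \<sqinter> \<^bold>\<not> a \<sqsubseteq> \<^bold>\<not> c\<close>, so that \<open>a \<sqinter> \<^bold>\<not> a\<close> lies below
  \<open>\<^bold>\<not> a \<sqinter> \<^bold>\<not> c = \<^bold>\<not> (a \<squnion> c) = \<zero>\<close>.\<close>

lemma (in kleene_alg) neg_eq_complement:
  assumes a: "a \<in> carrier A" and c: "c \<in> carrier A"
    and meet: "a \<sqinter> c = \<zero>" and join: "a \<squnion> c = \<one>"
  shows "\<^bold>\<not> a = c"
proof -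
  have disj: "u \<sqinter> \<^bold>\<not> u = \<zero>"
    if u: "u \<in> carrier A" "v \<in> carrier A" "u \<sqinter> v = \<zero>" "u \<squnion> v = \<one>" for u v
  proof -
    have "u \<sqinter> \<^bold>\<not> u = (u \<sqinter> \<^bold>\<not> u) \<sqinter> (v \<squnion> \<^bold>\<not> v)"
      using kleene[OF u(1,2)] by (simp add: alg_le_def)
    also have "\<dots> = ((u \<sqinter> \<^bold>\<not> u) \<sqinter> v) \<squnion> ((u \<sqinter> \<^bold>\<not> u) \<sqinter> \<^bold>\<not> v)"
      using u by (simp add: meet_join_distrib closed)
    also have "(u \<sqinter> \<^bold>\<not> u) \<sqinter> v = \<zero>"
      using u by (metis meet_assoc meet_comm neg_closed alg_le_def zero_least)
    also have "(u \<sqinter> \<^bold>\<not> u) \<sqinter> \<^bold>\<not> v = u \<sqinter> \<zero>"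
      using u by (metis meet_assoc neg_closed neg_join neg_one)
    also have "u \<sqinter> \<zero> = \<zero>"
      using u by (metis meet_comm zero_closed alg_le_def zero_least)
    finally show ?thesis by (simp add: zero_join zero_closed)
  qed
  have a0: "a \<sqinter> \<^bold>\<not> a = \<zero>" using disj[OF a c meet join] .
  have a1: "a \<squnion> \<^bold>\<not> a = \<one>"
    using a0 a by (metis join_comm neg_closed neg_meet neg_neg neg_zero)
  \<comment> \<open>complements in a distributive lattice are unique\<close>
  have "\<^bold>\<not> a = \<^bold>\<not> a \<sqinter> (a \<squnion> c)" using join a by (simp add: meet_one closed)
  also have "\<dots> = \<^bold>\<not> a \<sqinter> c"
    using a c a0 by (metis meet_join_distrib meet_comm zero_join meet_closed neg_closed)
  also have "\<dots> = c \<sqinter> (a \<squnion> \<^bold>\<not> a)"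
    using a c meet by (metis meet_join_distrib meet_comm zero_join meet_closed neg_closed)
  also have "\<dots> = c" using a1 c by (simp add: meet_one)
  finally show ?thesis .
qed

context kleene_stone_alg
begin

lemma meet_til:
  assumes x: "x \<in> carrier A"
  shows "x \<sqinter> \<sim> x = \<zero>"
proof (rule le_antisym)
  have "\<sim> (\<sim> (x \<sqinter> \<sim> x)) = \<zero>"
    using x by (simp add: til_meet_til til_join_til_til til_one)
  then show "x \<sqinter> \<sim> x \<sqsubseteq> \<zero>"
    using le_til_til[of "x \<sqinter> \<sim> x"] x by (simp add: closed)
qed (use x in \<open>simp_all add: closed zero_least\<close>)

lemma neg_til: "x \<in> carrier A \<Longrightarrow> \<^bold>\<not> (\<sim> x) = \<sim> (\<sim> x)"
  by (rule neg_eq_complement) (simp_all add: closed meet_til til_join_til_til)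

end

lemma generated_variety_bz_algebra:
  assumes "bz_algebra K" "A \<in> generated_variety K"
  shows "bz_algebra A"
  using assms by (auto simp: generated_variety_def equational_class_def)

lemma generated_variety_identity:
  fixes s t :: "nat tm"
  assumes "bz_algebra K" "A \<in> generated_variety K"
    and "\<And>\<rho>. range \<rho> \<subseteq> carrier K \<Longrightarrow> eval K \<rho> s = eval K \<rho> t"
    and "range \<sigma> \<subseteq> carrier A"
  shows "eval A \<sigma> s = eval A \<sigma> t"
proof -
  have "K \<in> equational_class {(s, t)}"
    using assms(1,3) by (auto simp: equational_class_def satisfies_def)
  then have "satisfies A (s, t)"
    using assms(2) by (auto simp: generated_variety_def equational_class_def)
  then show ?thesis using assms(4) by (auto simp: satisfies_def)
qed

lemma generated_variety_kleene_stone: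
  fixes K :: "'b bz_alg" and A :: "'a bz_alg"
  assumes K: "kleene_stone_alg K" and gv: "A \<in> generated_variety K"
  shows "kleene_stone_alg A"
proof -
  interpret K: kleene_stone_alg K by (rule K)
  have bK: "bz_algebra K" by unfold_locales
  interpret A: bz_algebra A by (rule generated_variety_bz_algebra[OF bK gv])
  let ?x = "Var 0 :: nat tm" and ?y = "Var 1 :: nat tm" and ?z = "Var 2 :: nat tm"
  let ?\<sigma> = "\<lambda>x y z (n::nat). if n = 0 then x else if n = 1 then y else z"
  have id3: "eval A (?\<sigma> x y z) s = eval A (?\<sigma> x y z) t"
    if "\<And>\<rho>. (\<And>n. \<rho> n \<in> carrier K) \<Longrightarrow> eval K \<rho> s = eval K \<rho> t"
      and "x \<in> carrier A" "y \<in> carrier A" "z \<in> carrier A" for s t x y z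
    using generated_variety_identity[OF bK gv, of s t "?\<sigma> x y z"] that
    by (auto simp: image_subset_iff)
  have neg_til: "\<^bold>\<not>\<^bsub>A\<^esub> (\<sim>\<^bsub>A\<^esub> x) = \<sim>\<^bsub>A\<^esub> (\<sim>\<^bsub>A\<^esub> x)" if "x \<in> carrier A" for x
    using id3[of "Neg (Til ?x)" "Til (Til ?x)" x x x] that by (simp add: K.neg_til)
  show ?thesis
  proof unfold_locales
    fix x y z assume c: "x \<in> carrier A" "y \<in> carrier A" "z \<in> carrier A"
    show "x \<sqinter>\<^bsub>A\<^esub> y \<sqinter>\<^bsub>A\<^esub> z = x \<sqinter>\<^bsub>A\<^esub> (y \<sqinter>\<^bsub>A\<^esub> z)"
      using id3[of "Meet (Meet ?x ?y) ?z" "Meet ?x (Meet ?y ?z)" x y z] c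
      by (simp add: K.meet_assoc)
    show "x \<squnion>\<^bsub>A\<^esub> y \<squnion>\<^bsub>A\<^esub> z = x \<squnion>\<^bsub>A\<^esub> (y \<squnion>\<^bsub>A\<^esub> z)"
      using id3[of "Join (Join ?x ?y) ?z" "Join ?x (Join ?y ?z)" x y z] c
      by (simp add: K.join_assoc)
    show "x \<sqinter>\<^bsub>A\<^esub> (y \<squnion>\<^bsub>A\<^esub> z) = x \<sqinter>\<^bsub>A\<^esub> y \<squnion>\<^bsub>A\<^esub> x \<sqinter>\<^bsub>A\<^esub> z"
      using id3[of "Meet ?x (Join ?y ?z)" "Join (Meet ?x ?y) (Meet ?x ?z)" x y z] c
      by (simp add: K.meet_join_distrib)
  next
    fix x y assume c: "x \<in> carrier A" "y \<in> carrier A"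
    show "x \<sqinter>\<^bsub>A\<^esub> y = y \<sqinter>\<^bsub>A\<^esub> x"
      using id3[of "Meet ?x ?y" "Meet ?y ?x" x y x] c by (simp add: K.meet_comm)
    show "x \<squnion>\<^bsub>A\<^esub> y = y \<squnion>\<^bsub>A\<^esub> x"
      using id3[of "Join ?x ?y" "Join ?y ?x" x y x] c by (simp add: K.join_comm)
    show "x \<sqinter>\<^bsub>A\<^esub> (x \<squnion>\<^bsub>A\<^esub> y) = x"
      using id3[of "Meet ?x (Join ?x ?y)" ?x x y x] c by (simp add: K.meet_join_absorb)
    show "x \<squnion>\<^bsub>A\<^esub> x \<sqinter>\<^bsub>A\<^esub> y = x"
      using id3[of "Join ?x (Meet ?x ?y)" ?x x y x] c by (simp add: K.join_meet_absorb)
    show "x \<sqinter>\<^bsub>A\<^esub> \<^bold>\<not>\<^bsub>A\<^esub> x \<sqsubseteq>\<^bsub>A\<^esub> y \<squnion>\<^bsub>A\<^esub> \<^bold>\<not>\<^bsub>A\<^esub> y"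
      using id3[of "Meet (Meet ?x (Neg ?x)) (Join ?y (Neg ?y))" "Meet ?x (Neg ?x)" x y x] c
      by (simp add: K.kleene[unfolded alg_le_def] alg_le_def)
    show "\<sim>\<^bsub>A\<^esub> (x \<squnion>\<^bsub>A\<^esub> y) = \<sim>\<^bsub>A\<^esub> x \<sqinter>\<^bsub>A\<^esub> \<sim>\<^bsub>A\<^esub> y"
      using id3[of "Til (Join ?x ?y)" "Meet (Til ?x) (Til ?y)" x y x] c
      by (simp add: K.til_join)
    show "\<sim>\<^bsub>A\<^esub> (x \<sqinter>\<^bsub>A\<^esub> \<sim>\<^bsub>A\<^esub> y) = \<sim>\<^bsub>A\<^esub> x \<squnion>\<^bsub>A\<^esub> \<sim>\<^bsub>A\<^esub> (\<sim>\<^bsub>A\<^esub> y)"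
      using id3[of "Til (Meet ?x (Til ?y))" "Join (Til ?x) (Til (Til ?y))" x y x] c
      by (simp add: K.til_meet_til)
    show "\<sim>\<^bsub>A\<^esub> (x \<sqinter>\<^bsub>A\<^esub> y) = \<sim>\<^bsub>A\<^esub> x \<squnion>\<^bsub>A\<^esub> \<sim>\<^bsub>A\<^esub> y"
      using id3[of "Til (Meet ?x ?y)" "Join (Til ?x) (Til ?y)" x y x] c
      by (simp add: K.til_meet)
    \<comment> \<open>antitonicity, from the identity saying that \<open>\<^bold>\<not> y\<close> lies below \<open>\<^bold>\<not> (x \<sqinter> y)\<close>\<close>
    assume "x \<sqsubseteq>\<^bsub>A\<^esub> y"
    then have xy: "x \<sqinter>\<^bsub>A\<^esub> y = x" by (simp add: alg_le_def)
    have "\<^bold>\<not>\<^bsub>K\<^esub> v \<sqinter>\<^bsub>K\<^esub> \<^bold>\<not>\<^bsub>K\<^esub> (u \<sqinter>\<^bsub>K\<^esub> v) = \<^bold>\<not>\<^bsub>K\<^esub> v"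
      if "u \<in> carrier K" "v \<in> carrier K" for u v
      using K.neg_antitone[OF _ _ K.meet_le2[OF that]] that by (simp add: K.closed alg_le_def)
    then show "\<^bold>\<not>\<^bsub>A\<^esub> y \<sqsubseteq>\<^bsub>A\<^esub> \<^bold>\<not>\<^bsub>A\<^esub> x"
      using id3[of "Meet (Neg ?y) (Neg (Meet ?x ?y))" "Neg ?y" x y x] c
      by (simp add: alg_le_def xy)
  next
    fix x assume c: "x \<in> carrier A"
    show "\<zero>\<^bsub>A\<^esub> \<sqsubseteq>\<^bsub>A\<^esub> x"
      using id3[of "Meet Zero ?x" Zero x x x] c
      by (simp add: K.zero_least[unfolded alg_le_def] alg_le_def)
    show "x \<sqsubseteq>\<^bsub>A\<^esub> \<one>\<^bsub>A\<^esub>"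
      using id3[of "Meet ?x One" ?x x x x] c by (simp add: K.meet_one alg_le_def)
    show "\<^bold>\<not>\<^bsub>A\<^esub> (\<^bold>\<not>\<^bsub>A\<^esub> x) = x"
      using id3[of "Neg (Neg ?x)" ?x x x x] c by (simp add: K.neg_neg)
    show "x \<sqsubseteq>\<^bsub>A\<^esub> \<sim>\<^bsub>A\<^esub> (\<sim>\<^bsub>A\<^esub> x)"
      using id3[of "Meet ?x (Til (Til ?x))" ?x x x x] c
      by (simp add: K.le_til_til[unfolded alg_le_def] alg_le_def)
    show "\<sim>\<^bsub>A\<^esub> x \<squnion>\<^bsub>A\<^esub> \<sim>\<^bsub>A\<^esub> (\<sim>\<^bsub>A\<^esub> x) = \<one>\<^bsub>A\<^esub>"
      using id3[of "Join (Til ?x) (Til (Til ?x))" One x x x] c by (simp add: K.til_join_til_til)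
  next
    show "\<sim>\<^bsub>A\<^esub> \<zero>\<^bsub>A\<^esub> = \<one>\<^bsub>A\<^esub>"
      using id3[of "Til Zero" One "\<zero>\<^bsub>A\<^esub>" "\<zero>\<^bsub>A\<^esub>" "\<zero>\<^bsub>A\<^esub>"] A.zero_closed
      by (simp add: K.til_zero)
    show "\<sim>\<^bsub>A\<^esub> \<one>\<^bsub>A\<^esub> = \<zero>\<^bsub>A\<^esub>"
      using id3[of "Til One" Zero "\<zero>\<^bsub>A\<^esub>" "\<zero>\<^bsub>A\<^esub>" "\<zero>\<^bsub>A\<^esub>"] A.zero_closed
      by (simp add: K.til_one)
  next
    fix x assume "x \<in> til_image A"
    then show "\<^bold>\<not>\<^bsub>A\<^esub> x \<in> til_image A"
      using neg_til A.til_closed by (auto simp: til_image_def)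
  qed
qed


section \<open>Separation by homomorphisms into the five-element chain\<close>

context kleene_stone_alg
begin

text \<open>For prime \<open>F\<close> this is the preimage of \<open>F\<close> under \<open>\<sim> \<sim>\<close>, and the largest prime filter with the
  same elements of the form \<open>\<sim> b\<close> as \<open>F\<close>.\<close>

definition til_hull :: "'a set \<Rightarrow> 'a set" where
  "til_hull F = {a \<in> carrier A. \<sim> a \<notin> F}"

lemma til_mem_iff:
  assumes "prime_filter F" "a \<in> carrier A"
  shows "\<sim> (\<sim> a) \<in> F \<longleftrightarrow> \<sim> a \<notin> F"
  using assms til_join_til_til[of a] meet_til[of "\<sim> a"] til_closed[of a] til_closed[of "\<sim> a"]
  unfolding prime_filter_def lattice_filter_def by metis

lemma prime_filter_til_hull:
  assumes "prime_filter F"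
  shows "prime_filter (til_hull F)"
  using assms
  by (auto simp: prime_filter_def lattice_filter_def til_hull_def closed til_meet til_join
      til_zero til_one)

lemma til_mem_dual:
  assumes "prime_filter F" "a \<in> carrier A"
  shows "\<sim> a \<in> dual_filter F \<longleftrightarrow> \<sim> a \<in> F"
  using assms by (simp add: dual_filter_def neg_til til_mem_iff closed)

lemma til_mem_til_hull:
  assumes "prime_filter F" "a \<in> carrier A"
  shows "\<sim> a \<in> til_hull F \<longleftrightarrow> \<sim> a \<in> F"
  using assms by (simp add: til_hull_def til_mem_iff closed)

lemma subset_til_hull:
  assumes F: "prime_filter F"
  shows "F \<subseteq> til_hull F"
proof
  fix a assume a: "a \<in> F"
  then have c: "a \<in> carrier A" using F by (auto simp: prime_filter_def lattice_filter_def)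
  then have "\<sim> (\<sim> a) \<in> F"
    using F a filter_up[of F a] le_til_til by (auto simp: prime_filter_def closed)
  then show "a \<in> til_hull F" using F c til_mem_iff by (simp add: til_hull_def)
qed

lemma til_hull_dual: "prime_filter F \<Longrightarrow> til_hull (dual_filter F) = til_hull F"
  using til_mem_dual by (auto simp: til_hull_def)

text \<open>Lattice homomorphisms into a finite chain correspond to finite chains of prime filters; the
  value at \<open>a\<close> is the number of filters in the chain that contain \<open>a\<close>.\<close>

definition chain_map :: "'a set \<Rightarrow> 'a \<Rightarrow> nat" where
  "chain_map P a = of_bool (a \<in> til_hull P) + of_bool (a \<in> P) + of_bool (a \<in> dual_filter P) +
    of_bool (a \<in> dual_filter (til_hull P))"

lemma chain_filters:
  assumes P: "prime_filter P"
  shows "P \<subseteq> til_hull P" "dual_filter P \<subseteq> til_hull P"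
    and "dual_filter (til_hull P) \<subseteq> P" "dual_filter (til_hull P) \<subseteq> dual_filter P"
proof -
  note d = prime_filter_dual[OF P]
  show 1: "P \<subseteq> til_hull P" by (rule subset_til_hull[OF P])
  show 2: "dual_filter P \<subseteq> til_hull P" using subset_til_hull[OF d] til_hull_dual[OF P] by simp
  show "dual_filter (til_hull P) \<subseteq> dual_filter P" using 1 by (auto simp: dual_filter_def)
  have "dual_filter (til_hull P) \<subseteq> dual_filter (dual_filter P)"
    using 2 by (auto simp: dual_filter_def)
  then show "dual_filter (til_hull P) \<subseteq> P"
    using P dual_dual[of P] by (simp add: prime_filter_def lattice_filter_def)
qed

lemma chain_map_hom:
  assumes P: "prime_filter P"
  shows "chain_map P \<in> alg_hom A D5"
proof -
  note T = prime_filter_til_hull[OF P]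
  note D = prime_filter_dual[OF P] prime_filter_dual[OF T]
  note chain = chain_filters[OF P] dual_filter_comparable[OF P]
  have mem_meet: "a \<sqinter> b \<in> F \<longleftrightarrow> a \<in> F \<and> b \<in> F" and mem_join: "a \<squnion> b \<in> F \<longleftrightarrow> a \<in> F \<or> b \<in> F"
    if "prime_filter F" "a \<in> carrier A" "b \<in> carrier A" for F a b
    using that by (auto simp: prime_filter_def lattice_filter_def)
  have ends: "\<zero> \<notin> F" "\<one> \<in> F" if "prime_filter F" for F
    using that by (auto simp: prime_filter_def lattice_filter_def)
  have le4: "chain_map P a \<le> 4" for a by (simp add: chain_map_def of_bool_def)
  \<comment> \<open>on a chain of prime filters, the sets of filters containing \<open>a\<close> and \<open>b\<close> are nested, so the
    sizes of their intersection and union are the minimum and maximum of the two sizes\<close>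
  have "chain_map P (a \<sqinter> b) = min (chain_map P a) (chain_map P b)"
    "chain_map P (a \<squnion> b) = max (chain_map P a) (chain_map P b)"
    if "a \<in> carrier A" "b \<in> carrier A" for a b
    using that P T D chain subsetD[OF chain(1), of a] subsetD[OF chain(2), of a]
      subsetD[OF chain(3), of a] subsetD[OF chain(4), of a]
      subsetD[OF chain(1), of b] subsetD[OF chain(2), of b]
      subsetD[OF chain(3), of b] subsetD[OF chain(4), of b]
    by (auto simp: chain_map_def mem_meet mem_join of_bool_def)
  moreover have "chain_map P (\<^bold>\<not> a) = 4 - chain_map P a" if "a \<in> carrier A" for a
  proof -
    have "\<^bold>\<not> a \<in> dual_filter F \<longleftrightarrow> a \<notin> F" "\<^bold>\<not> a \<in> F \<longleftrightarrow> a \<notin> dual_filter F" for F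
      using that by (auto simp: dual_filter_def neg_neg closed)
    then show ?thesis by (simp add: chain_map_def of_bool_def)
  qed
  moreover have "chain_map P (\<sim> a) = (if chain_map P a = 0 then 4 else 0)"
    if a: "a \<in> carrier A" for a
  proof -
    have "chain_map P (\<sim> a) = (if \<sim> a \<in> P then 4 else 0)"
      using a P T by (simp add: chain_map_def til_mem_dual til_mem_til_hull)
    moreover have "chain_map P a = 0 \<longleftrightarrow> a \<notin> til_hull P"
      using chain by (auto simp: chain_map_def of_bool_def)
    ultimately show ?thesis using a by (simp add: til_hull_def)
  qed
  moreover have "chain_map P \<zero> = 0" "chain_map P \<one> = 4"
    using P T D by (simp_all add: chain_map_def ends)
  ultimately show ?thesis using le4 by (auto simp: alg_hom_def D5_def)
qed

text \<open>In a chain of sets, the number of members that contain a point determines which members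
  these are, and \<open>P\<close> itself is in the chain.\<close>

lemma chain_map_separates:
  assumes P: "prime_filter P" and "x \<in> P" "y \<notin> P"
  shows "chain_map P x \<noteq> chain_map P y"
  using assms(2,3) chain_filters[OF P] dual_filter_comparable[OF P]
  by (auto simp: chain_map_def of_bool_def)

lemma hom_to_D5_separation:
  assumes "x \<in> carrier A" "y \<in> carrier A" "x \<noteq> y"
  obtains h where "h \<in> alg_hom A D5" "h x \<noteq> h y"
proof -
  have *: "\<exists>h \<in> alg_hom A D5. h u \<noteq> h v"
    if uv: "u \<in> carrier A" "v \<in> carrier A" "\<not> u \<sqsubseteq> v" for u v
  proof -
    obtain P where P: "prime_filter P" "u \<in> P" "v \<notin> P"
      by (rule prime_filter_separation[OF uv])
    show ?thesis
      using chain_map_hom[OF P(1)] chain_map_separates[OF P] by (intro bexI[of _ "chain_map P"])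
  qed
  have "\<exists>h \<in> alg_hom A D5. h x \<noteq> h y"
  proof (cases "x \<sqsubseteq> y")
    case True
    then have "\<not> y \<sqsubseteq> x" using le_antisym assms by blast
    then obtain h where "h \<in> alg_hom A D5" "h y \<noteq> h x" using *[OF assms(2,1)] by blast
    then show ?thesis by (intro bexI[of _ h]) simp_all
  next
    case False
    then show ?thesis by (rule *[OF assms(1,2)])
  qed
  then show thesis using that by blast
qed

lemma D5_identity:
  fixes \<rho> :: "'v \<Rightarrow> 'a"
  assumes D5: "\<And>\<sigma>. range \<sigma> \<subseteq> carrier D5 \<Longrightarrow> eval D5 \<sigma> s = eval D5 \<sigma> t"
    and \<rho>: "range \<rho> \<subseteq> carrier A"
  shows "eval A \<rho> s = eval A \<rho> t"
proof (rule ccontr)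
  assume ne: "eval A \<rho> s \<noteq> eval A \<rho> t"
  have bz: "bz_algebra A" by unfold_locales
  have cl: "eval A \<rho> s \<in> carrier A" "eval A \<rho> t \<in> carrier A"
    using \<rho> by (auto intro!: eval_closed[OF bz])
  obtain h where h: "h \<in> alg_hom A D5" and sep: "h (eval A \<rho> s) \<noteq> h (eval A \<rho> t)"
    by (rule hom_to_D5_separation[OF cl ne])
  have "range (h \<circ> \<rho>) \<subseteq> carrier D5" using h \<rho> by (auto simp: alg_hom_def)
  then show False using D5[of "h \<circ> \<rho>"] eval_hom[OF bz h \<rho>] sep by simp
qed

end

theorem theorem32:
  shows "(generated_variety D5 :: 'a bz_alg set) = {A. kleene_stone_alg A}"
proof (intro set_eqI iffI CollectI; (elim CollectE)?)
  fix A :: "'a bz_alg" assume "A \<in> generated_variety D5"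
  then show "kleene_stone_alg A" by (rule generated_variety_kleene_stone[OF D5_kleene_stone])
next
  fix A :: "'a bz_alg" assume "kleene_stone_alg A"
  then interpret kleene_stone_alg A .
  show "A \<in> generated_variety D5"
    unfolding generated_variety_def equational_class_def satisfies_def
    using D5_identity bz_algebra_axioms by blast
qed

end
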